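(* For all integers $k\ge 0$, \[ T_k(t,q)=\sum_{j=0}^k \sum_{i=0}^j (-1)^{j+i}\, t^{2i} q^{j^2+i^2+i} \genfrac{[}{]}{0pt}{}{k-j}{i}_{q^2} \left( \genfrac{[}{]}{0pt}{}{k-i}{j-i}_{q^2} + t \genfrac{[}{]}{0pt}{}{k-i-1}{j-i-1}_{q^2} \right). \]
   Context: The polynomials $T_k(t,q)$ in the indeterminates $t,q$ are defined by $T_0(t,q)=1$ and, for $k\ge1$, \[ T_k(t,q) = T_{k-1}(t,q) + (1+t)(-q)^{k^2} + (1-t^2) \sum_{i=1}^{k-1} (-q)^{k^2-i^2}\, T_{i-1}(t,q). \] For $0\le m\le n$ the $q$-binomial coefficient is $\genfrac{[}{]}{0pt}{}{n}{m}_{q}=\frac{(q;q)_n}{(q;q)_m(q;q)_{n-m}}$ with $(a;q)_n=\prod_{l=0}^{n-1}(1-aq^l)$; the subscript $q^2$ means $q$ is replaced by $q^2$. By convention $\genfrac{[}{]}{0pt}{}{n}{m}_{q}=0$ if $m<0$ (for any integer $n$, including $n=-1$) or if $m>n\ge 0$. *)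

theory Defs
  imports "HOL-Computational_Algebra.Computational_Algebra"
begin

text \<open>
  The ring \<open>\<int>[t,q]\<close> is represented as \<open>int poly poly\<close>: polynomials in \<open>t\<close> whose
  coefficients are polynomials in \<open>q\<close>.  The field \<open>\<rat>(t,q)\<close> is its fraction field
  \<open>int poly poly fract\<close>, in which the quotients defining the q-binomial coefficients are formed.
\<close>

definition t_ind :: "int poly poly" where
  "t_ind = [:0, 1:]"

definition q_ind :: "int poly poly" where
  "q_ind = [:[:0, 1:]:]"

text \<open>In the second equation \<open>k = Suc n\<close>, so that \<open>i\<close> ranges over \<open>1, \<dots>, k - 1\<close>.\<close>

fun T :: "nat \<Rightarrow> int poly poly" where
  "T 0 = 1"
| "T (Suc n) = T n + (1 + t_ind) * (- q_ind) ^ ((Suc n)\<^sup>2)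
     + (1 - t_ind\<^sup>2) * (\<Sum>i = 1..n. (- q_ind) ^ ((Suc n)\<^sup>2 - i\<^sup>2) * T (i - 1))"

definition qpoch :: "'a::comm_ring_1 \<Rightarrow> 'a \<Rightarrow> nat \<Rightarrow> 'a" where
  "qpoch a q n = (\<Prod>l<n. 1 - a * q ^ l)"

text \<open>
  The arguments are integers because the lower one may be negative, and the upper one may
  be \<open>-1\<close>.  The value is 0 if \<open>m < 0\<close> or \<open>m > n \<ge> 0\<close>.  The remaining case \<open>n < 0 \<le> m\<close> is given
  the value 0 only to make the function total.
  The base \<open>q\<close> is meant not to be a root of unity, so that the denominator does not vanish.
\<close>

definition qbinom :: "'a::field \<Rightarrow> int \<Rightarrow> int \<Rightarrow> 'a" where
  "qbinom q n m =
     (if 0 \<le> m \<and> m \<le> n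
      then qpoch q q (nat n) / (qpoch q q (nat m) * qpoch q q (nat (n - m)))
      else 0)"

end

theory Submission
  imports Defs
begin

text \<open>
  Differencing the definition of \<open>T\<close> gives the three-term recurrence
  \<open>T\<^bsub>k+2\<^esub> = (1 - q\<^bsup>2k+3\<^esup>) T\<^bsub>k+1\<^esub> + t\<^sup>2 q\<^bsup>2k+3\<^esup> T\<^bsub>k\<^esub>\<close>.  On the other side, fix \<open>i\<close> and
  put \<open>j = i + s\<close>: trinomial revision pulls a factor free of \<open>s\<close> out of the product of the two
  \<open>q\<close>-binomials, and the \<open>q\<close>-binomial theorem evaluates the sum over \<open>s\<close>.  The coefficients of
  \<open>t\<^bsup>2i\<^esup>\<close> and \<open>t\<^bsup>2i+1\<^esup>\<close> thereby become products, of the same shape with a parameter \<open>z = q\<close>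
  and \<open>z = q\<^sup>3\<close> respectively, and the two Pascal rules show that they satisfy the same recurrence.
\<close>

section \<open>q-binomial coefficients: Pascal rules, trinomial revision, q-binomial theorem\<close>

abbreviation qbin :: "'a::field \<Rightarrow> nat \<Rightarrow> nat \<Rightarrow> 'a" where
  "qbin Q n m \<equiv> qbinom Q (int n) (int m)"

lemma qpoch_0 [simp]: "qpoch a Q 0 = 1"
  by (simp add: qpoch_def)

lemma qpoch_Suc: "qpoch a Q (Suc n) = qpoch a Q n * (1 - a * Q ^ n)"
  by (simp add: qpoch_def)

lemma qpoch_Suc_shift: "qpoch a Q (Suc n) = (1 - a) * qpoch (a * Q) Q n"
  unfolding qpoch_def prod.lessThan_Suc_shift by (simp add: mult_ac)

lemma qpoch_self_nonzero:
  fixes Q :: "'a::field"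
  assumes "\<forall>n>0. Q ^ n \<noteq> 1"
  shows "qpoch Q Q n \<noteq> 0"
  using assms by (auto simp: qpoch_def simp flip: power_Suc)

lemma qbin_eq: "m \<le> n \<Longrightarrow> qbin Q n m = qpoch Q Q n / (qpoch Q Q m * qpoch Q Q (n - m))"
  by (simp add: qbinom_def flip: of_nat_diff)

lemma qbin_eq_0 [simp]: "n < m \<Longrightarrow> qbin Q n m = 0"
  by (simp add: qbinom_def)

context
  fixes Q :: "'a::field"
  assumes nonroot: "\<forall>n>0. Q ^ n \<noteq> 1"
begin

lemma qbin_0_right: "qbin Q n 0 = 1"
  using qpoch_self_nonzero[OF nonroot] by (simp add: qbin_eq[of 0, simplified])

lemma qbin_self: "qbin Q n n = 1"
  using qpoch_self_nonzero[OF nonroot] by (simp add: qbin_eq)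

text \<open>Over a common denominator this is
  \<open>1 - Q^(n+1) = (1 - Q^(m+1)) + Q^(m+1) * (1 - Q^(n-m))\<close>; the second Pascal rule
  splits the same numerator as \<open>Q^(n-m) * (1 - Q^(m+1)) + (1 - Q^(n-m))\<close>.\<close>

lemma qbin_Suc_Suc: "qbin Q (Suc n) (Suc m) = qbin Q n m + Q ^ Suc m * qbin Q n (Suc m)"
proof (cases "m < n")
  case True
  then obtain d where d: "n = Suc (m + d)"
    using less_imp_Suc_add by blast
  have "1 - Q ^ Suc m \<noteq> 0" "1 - Q ^ Suc d \<noteq> 0"
    using nonroot[rule_format, of "Suc m"] nonroot[rule_format, of "Suc d"] by auto
  with qpoch_self_nonzero[OF nonroot] show ?thesis
    by (simp add: d qbin_eq qpoch_Suc Suc_diff_le divide_simps del: of_nat_Suc)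
      (simp add: algebra_simps power_add)
next
  case False
  then show ?thesis
    using qbin_self by (cases "m = n") (simp_all del: of_nat_Suc)
qed

lemma qbin_Suc_Suc':
  assumes "m \<le> n"
  shows "qbin Q (Suc n) (Suc m) = Q ^ (n - m) * qbin Q n m + qbin Q n (Suc m)"
proof (cases "m < n")
  case True
  then obtain d where d: "n = Suc (m + d)"
    using less_imp_Suc_add by blast
  have "1 - Q ^ Suc m \<noteq> 0" "1 - Q ^ Suc d \<noteq> 0"
    using nonroot[rule_format, of "Suc m"] nonroot[rule_format, of "Suc d"] by auto
  with qpoch_self_nonzero[OF nonroot] show ?thesis
    by (simp add: d qbin_eq qpoch_Suc Suc_diff_le divide_simps del: of_nat_Suc)
      (simp add: algebra_simps power_add)
next
  case False
  then show ?thesis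
    using assms qbin_self by (simp del: of_nat_Suc)
qed

text \<open>For \<open>s + i \<le> n\<close> both products are the q-trinomial coefficient with
  parts \<open>s\<close>, \<open>i\<close>, \<open>n - s - i\<close>; otherwise both vanish.\<close>

lemma qbin_trinomial_revision:
  assumes "s \<le> n"
  shows "qbin Q (n - s) i * qbin Q n s = qbin Q n i * qbin Q (n - i) s"
proof (cases "s + i \<le> n")
  case True
  then have "n - s - i = n - i - s" "s \<le> n" "i \<le> n" "i \<le> n - s" "s \<le> n - i"
    by auto
  with qpoch_self_nonzero[OF nonroot] show ?thesis
    by (simp add: qbin_eq del: of_nat_diff)
next
  case False
  then show ?thesis
    using assms by (cases "i \<le> n") (simp_all del: of_nat_diff)
qed

text \<open>In base \<open>Q = q^2\<close> the weight \<open>q^(s^2)\<close> is \<open>q^s\<close>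
  times the usual \<open>Q^(s(s-1)/2)\<close>, hence the argument \<open>z * q\<close>. The bound
  \<open>N\<close> allows vanishing terms beyond \<open>n\<close>.\<close>

lemma qbinomial_theorem:
  assumes "n \<le> N" and "Q = q\<^sup>2"
  shows "(\<Sum>s\<le>N. (- z) ^ s * q ^ s\<^sup>2 * qbin Q n s) = qpoch (z * q) Q n"
proof -
  have "(\<Sum>s\<le>n. (- z) ^ s * q ^ s\<^sup>2 * qbin Q n s) = qpoch (z * q) Q n" for z
  proof (induction n arbitrary: z)
    case 0
    then show ?case by (simp add: qbin_0_right[of 0, simplified])
  next
    case (Suc n)
    let ?f = "\<lambda>z s. (- z) ^ s * q ^ s\<^sup>2 * qbin Q n s"
    \<comment> \<open>The Pascal factor \<open>Q^(s+1)\<close> is absorbed by replacing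
      \<open>z\<close> with \<open>z * Q\<close>; in the other summand
      \<open>(s+1)^2 = s^2 + 2s + 1\<close> supplies \<open>q * Q^s\<close>. The induction
      hypothesis is therefore used at \<open>z * Q\<close>.\<close>
    have step: "(- z) ^ Suc s * q ^ (Suc s)\<^sup>2 * qbin Q (Suc n) (Suc s)
        = - z * q * ?f (z * Q) s + ?f (z * Q) (Suc s)" for s
      unfolding qbin_Suc_Suc power_minus[of z] power_minus[of "z * Q"]
      by (simp add: \<open>Q = q\<^sup>2\<close> power2_eq_square algebra_simps power_add power_mult_distrib
          flip: power_mult del: of_nat_Suc)
    have "(\<Sum>s\<le>Suc n. (- z) ^ s * q ^ s\<^sup>2 * qbin Q (Suc n) s)
        = 1 + (\<Sum>s\<le>n. - z * q * ?f (z * Q) s + ?f (z * Q) (Suc s))"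
      unfolding sum.atMost_Suc_shift step by (simp add: qbin_0_right[simplified] del: of_nat_Suc)
    also have "\<dots> = - z * q * (\<Sum>s\<le>n. ?f (z * Q) s) + (\<Sum>s\<le>Suc n. ?f (z * Q) s)"
      unfolding sum.atMost_Suc_shift sum.distrib sum_distrib_left
      by (simp add: qbin_0_right[simplified] add_ac del: of_nat_Suc)
    also have "(\<Sum>s\<le>Suc n. ?f (z * Q) s) = (\<Sum>s\<le>n. ?f (z * Q) s)"
      by (simp del: of_nat_Suc)
    finally show ?case
      unfolding Suc.IH qpoch_Suc_shift by (simp add: algebra_simps)
  qed
  moreover have "(\<Sum>s\<le>N. (- z) ^ s * q ^ s\<^sup>2 * qbin Q n s)
      = (\<Sum>s\<le>n. (- z) ^ s * q ^ s\<^sup>2 * qbin Q n s)"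
    using assms by (intro sum.mono_neutral_right) auto
  ultimately show ?thesis by simp
qed

section \<open>Product coefficients and their recurrence\<close>

definition qcoeff :: "'a \<Rightarrow> nat \<Rightarrow> nat \<Rightarrow> 'a" where
  "qcoeff z n i = qbin Q n i * qpoch (z * Q ^ i) Q (n - i)"

lemma qcoeff_eq_0 [simp]: "n < i \<Longrightarrow> qcoeff z n i = 0"
  by (simp add: qcoeff_def)

lemma qcoeff_Suc_0: "qcoeff z (Suc n) 0 = (1 - z * Q ^ n) * qcoeff z n 0"
  by (simp add: qcoeff_def qpoch_Suc qbin_0_right[simplified] del: of_nat_Suc)

lemma qcoeff_Suc_Suc:
  "qcoeff z (Suc n) (Suc i)
    = (1 - z * Q ^ Suc (n + i)) * qcoeff z n (Suc i) + Q ^ (n - i) * qcoeff z n i"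
proof (cases "i < n")
  case True
  then obtain d where d: "n = Suc (i + d)"
    using less_imp_Suc_add by blast
  let ?p = "qpoch (z * Q ^ Suc i) Q d"
  have "qcoeff z (Suc n) (Suc i)
      = (qbin Q (Suc n) (Suc i) - z * Q ^ n * qbin Q (Suc n) (Suc i)) * ?p"
    by (simp add: qcoeff_def d qpoch_Suc algebra_simps power_add del: of_nat_Suc)
  \<comment> \<open>The two copies of the same binomial are expanded by different Pascal rules. Then
    \<open>qbin Q n i\<close> collects \<open>Q^(n-i) - z * Q^n = Q^(n-i) * (1 - z * Q^i)\<close>,
    the missing first factor of the product in \<open>qcoeff z n i\<close>.\<close>
  also have "\<dots> = ((Q ^ (n - i) * qbin Q n i + qbin Q n (Suc i))
      - z * Q ^ n * (qbin Q n i + Q ^ Suc i * qbin Q n (Suc i))) * ?p"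
    using qbin_Suc_Suc'[of i n] qbin_Suc_Suc[of n i] True by (simp del: of_nat_Suc)
  also have "\<dots> = (1 - z * Q ^ Suc (n + i)) * qcoeff z n (Suc i) + Q ^ (n - i) * qcoeff z n i"
    by (simp add: qcoeff_def d qpoch_Suc_shift algebra_simps power_add Suc_diff_le del: of_nat_Suc)
  finally show ?thesis .
next
  case False
  then show ?thesis
    by (cases "i = n") (simp_all add: qcoeff_def qbin_self del: of_nat_Suc)
qed

text \<open>With \<open>x = t^2\<close>, the choice \<open>z = q\<close> gives the part of the
  right-hand side even in \<open>t\<close>, and \<open>z = q^3\<close> the odd part up to a factor
  and an index shift.\<close>

definition qsum :: "'a \<Rightarrow> 'a \<Rightarrow> nat \<Rightarrow> 'a" where
  "qsum x z k = (\<Sum>i\<le>k. (x * z) ^ i * Q ^ i\<^sup>2 * qcoeff z (k - i) i)"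

lemma qsum_0: "qsum x z 0 = 1"
  using qbin_0_right[of 0] by (simp add: qsum_def qcoeff_def)

lemma qsum_1: "qsum x z (Suc 0) = 1 - z"
  using qbin_0_right[of 1] by (simp add: qsum_def qcoeff_def qpoch_Suc qbinom_def)

lemma qsum_Suc_Suc:
  "qsum x z (Suc (Suc k)) = (1 - z * Q ^ Suc k) * qsum x z (Suc k) + x * z * Q ^ Suc k * qsum x z k"
proof -
  let ?c = "\<lambda>k i. (x * z) ^ i * Q ^ i\<^sup>2 * qcoeff z (k - i) i"
  have step: "?c (Suc (Suc k)) (Suc i)
      = (1 - z * Q ^ Suc k) * ?c (Suc k) (Suc i) + x * z * Q ^ Suc k * ?c k i" if "i \<le> k" for i
  proof -
    \<comment> \<open>The exponents match because \<open>(i+1)^2 + k - 2i = k + 1 + i^2\<close>.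
      Where the subtraction truncates, \<open>qcoeff\<close> is 0.\<close>
    have *: "Q ^ (Suc i)\<^sup>2 * (Q ^ (k - i - i) * qcoeff z (k - i) i)
        = Q ^ Suc k * Q ^ i\<^sup>2 * qcoeff z (k - i) i"
    proof (cases "i \<le> k - i")
      case True
      then have "(Suc i)\<^sup>2 + (k - i - i) = Suc k + i\<^sup>2"
        by (simp add: power2_eq_square)
      then show ?thesis
        by (metis power_add mult.assoc)
    qed simp
    have "?c (Suc (Suc k)) (Suc i) = (x * z) ^ Suc i * Q ^ (Suc i)\<^sup>2 *
      ((1 - z * Q ^ Suc k) * qcoeff z (k - i) (Suc i) + Q ^ (k - i - i) * qcoeff z (k - i) i)"
      using that qcoeff_Suc_Suc[of z "k - i" i] by (simp add: Suc_diff_le)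
    also have "\<dots> = (1 - z * Q ^ Suc k) * ((x * z) ^ Suc i * Q ^ (Suc i)\<^sup>2 * qcoeff z (k - i) (Suc i))
      + (x * z) ^ Suc i * (Q ^ (Suc i)\<^sup>2 * (Q ^ (k - i - i) * qcoeff z (k - i) i))"
      by (simp only: ring_distribs mult_ac)
    also have "\<dots> = (1 - z * Q ^ Suc k) * ?c (Suc k) (Suc i) + x * z * Q ^ Suc k * ?c k i"
      unfolding * by (simp add: mult_ac)
    finally show ?thesis .
  qed
  \<comment> \<open>The top index \<open>k + 2\<close> contributes nothing: its factor is
    \<open>qcoeff z 0 (k + 2) = 0\<close>.\<close>
  have "qsum x z (Suc (Suc k)) = ?c (Suc (Suc k)) 0 + (\<Sum>i\<le>k. ?c (Suc (Suc k)) (Suc i))"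
    unfolding qsum_def sum.atMost_Suc_shift[of _ "Suc k"] by simp
  also have "?c (Suc (Suc k)) 0 = (1 - z * Q ^ Suc k) * ?c (Suc k) 0"
    by (simp add: qcoeff_Suc_0)
  also have "(\<Sum>i\<le>k. ?c (Suc (Suc k)) (Suc i)) = (1 - z * Q ^ Suc k) * (\<Sum>i\<le>k. ?c (Suc k) (Suc i))
      + x * z * Q ^ Suc k * qsum x z k"
    unfolding sum_distrib_left qsum_def sum.distrib[symmetric]
    by (intro sum.cong refl step) simp
  finally show ?thesis
    unfolding qsum_def[of x z "Suc k"] sum.atMost_Suc_shift by (simp only: ring_distribs add.assoc)
qed

section \<open>Evaluation of the double sums\<close>

lemma sum_triangle_shift:
  fixes g :: "nat \<Rightarrow> nat \<Rightarrow> 'b::comm_monoid_add"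
  shows "(\<Sum>j\<le>k. \<Sum>i\<le>j. g j i) = (\<Sum>i\<le>k. \<Sum>s\<le>k - i. g (i + s) i)"
  unfolding sum.Sigma[OF finite_atMost ballI[OF finite_atMost]]
  by (rule sum.reindex_bij_witness[where i = "\<lambda>(i, s). (i + s, i)" and j = "\<lambda>(j, i). (i, j - i)"]) auto

text \<open>The weight \<open>y^j\<close> lets one evaluation serve both parities:
  \<open>y = 1\<close> for the even part, and \<open>y = Q\<close> for the odd part, where shifting
  \<open>j\<close> by one produces \<open>Q^j\<close>.\<close>

lemma double_sum_eq_qsum:
  assumes "Q = q\<^sup>2"
  shows "(\<Sum>j\<le>k. \<Sum>i\<le>j. (- 1) ^ (j + i) * x ^ i * y ^ j * q ^ (j\<^sup>2 + i\<^sup>2 + i)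
      * qbin Q (k - j) i * qbin Q (k - i) (j - i)) = qsum x (y * q) k"
proof -
  have "(\<Sum>s\<le>k - i. (- 1) ^ (i + s + i) * x ^ i * y ^ (i + s) * q ^ ((i + s)\<^sup>2 + i\<^sup>2 + i)
      * qbin Q (k - (i + s)) i * qbin Q (k - i) (i + s - i))
     = (x * (y * q)) ^ i * Q ^ i\<^sup>2 * qcoeff (y * q) (k - i) i" (is "sum ?f _ = ?c") for i
  proof -
    have "?f s = (x * (y * q)) ^ i * Q ^ i\<^sup>2 * qbin Q (k - i) i *
        ((- (y * Q ^ i)) ^ s * q ^ s\<^sup>2 * qbin Q (k - i - i) s)" if "s \<le> k - i" for s
    proof -
      \<comment> \<open>The exponent of \<open>q\<close> is \<open>i + 2i^2 + 2is + s^2\<close>, and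
        the sign reduces to \<open>(-1)^s\<close>.\<close>
      have "(- 1) ^ (i + s + i) * x ^ i * y ^ (i + s) * q ^ ((i + s)\<^sup>2 + i\<^sup>2 + i)
         = (x * (y * q)) ^ i * Q ^ i\<^sup>2 * ((- (y * Q ^ i)) ^ s * q ^ s\<^sup>2)"
        unfolding assms power_minus[of "y * _"]
        by (simp add: power2_eq_square power_add power_mult_distrib algebra_simps
          flip: power_mult)
      moreover have "qbin Q (k - (i + s)) i * qbin Q (k - i) (i + s - i)
          = qbin Q (k - i) i * qbin Q (k - i - i) s"
        using qbin_trinomial_revision[OF that] by simp
      ultimately show ?thesis by (simp add: mult_ac)
    qed
    then have "sum ?f {..k - i} = (x * (y * q)) ^ i * Q ^ i\<^sup>2 * qbin Q (k - i) i *
        (\<Sum>s\<le>k - i. (- (y * Q ^ i)) ^ s * q ^ s\<^sup>2 * qbin Q (k - i - i) s)"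
      by (simp add: sum_distrib_left)
    also have "\<dots> = ?c"
      \<comment> \<open>Here \<open>s\<close> runs up to \<open>k - i\<close>, while the upper index
        of the binomial is only \<open>k - i - i\<close>.\<close>
      by (subst qbinomial_theorem[OF _ assms]) (simp_all add: qcoeff_def mult_ac)
    finally show ?thesis .
  qed
  then show ?thesis
    unfolding sum_triangle_shift qsum_def by (simp only:)
qed

end

section \<open>Three-term recurrence for \<open>T\<close>\<close>

lemma T_Suc_Suc:
  "T (Suc (Suc k)) = (1 - q_ind ^ (2 * k + 3)) * T (Suc k) + t_ind\<^sup>2 * q_ind ^ (2 * k + 3) * T k"
proof -
  let ?p = "- q_ind"
  \<comment> \<open>Going from \<open>k + 1\<close> to \<open>k + 2\<close> multiplies every power
    of \<open>-q\<close> by \<open>(-q)^(2k+3)\<close>. So the increment of \<open>T\<close> is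
    multiplied by this factor as well, apart from the new summand \<open>i = k + 1\<close>, which
    brings in \<open>T k\<close>.\<close>
  have sq: "(Suc (Suc k))\<^sup>2 = (2 * k + 3) + (Suc k)\<^sup>2"
    by (simp add: power2_eq_square)
  have "?p ^ ((Suc (Suc k))\<^sup>2 - i\<^sup>2) = ?p ^ (2 * k + 3) * ?p ^ ((Suc k)\<^sup>2 - i\<^sup>2)"
    if "i \<le> Suc k" for i
  proof -
    from that have "i\<^sup>2 \<le> (Suc k)\<^sup>2" by (rule power_mono) simp
    then have "(Suc (Suc k))\<^sup>2 - i\<^sup>2 = (2 * k + 3) + ((Suc k)\<^sup>2 - i\<^sup>2)"
      unfolding sq by simp
    then show ?thesis by (simp only: power_add)
  qed
  then have "(\<Sum>i = 1..Suc k. ?p ^ ((Suc (Suc k))\<^sup>2 - i\<^sup>2) * T (i - 1))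
      = ?p ^ (2 * k + 3) * (\<Sum>i = 1..Suc k. ?p ^ ((Suc k)\<^sup>2 - i\<^sup>2) * T (i - 1))"
    unfolding sum_distrib_left by (intro sum.cong) (simp_all add: mult.assoc del: T.simps)
  also have "(\<Sum>i = 1..Suc k. ?p ^ ((Suc k)\<^sup>2 - i\<^sup>2) * T (i - 1))
      = (\<Sum>i = 1..k. ?p ^ ((Suc k)\<^sup>2 - i\<^sup>2) * T (i - 1)) + T k"
    by simp
  finally have sum_eq: "(\<Sum>i = 1..Suc k. ?p ^ ((Suc (Suc k))\<^sup>2 - i\<^sup>2) * T (i - 1))
      = ?p ^ (2 * k + 3) * ((\<Sum>i = 1..k. ?p ^ ((Suc k)\<^sup>2 - i\<^sup>2) * T (i - 1)) + T k)" .
  have "T (Suc (Suc k)) = T (Suc k) + ?p ^ (2 * k + 3) * ((1 + t_ind) * ?p ^ (Suc k)\<^sup>2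
      + (1 - t_ind\<^sup>2) * (\<Sum>i = 1..k. ?p ^ ((Suc k)\<^sup>2 - i\<^sup>2) * T (i - 1)) + (1 - t_ind\<^sup>2) * T k)"
    unfolding T.simps(2)[of "Suc k"] sum_eq unfolding sq power_add
    by (simp only: ring_distribs mult_ac add_ac)
  also have "\<dots> = T (Suc k) + ?p ^ (2 * k + 3) * (T (Suc k) - T k + (1 - t_ind\<^sup>2) * T k)"
    by simp
  also have "?p ^ (2 * k + 3) = - (q_ind ^ (2 * k + 3))"
    by (simp add: power_minus_odd)
  finally show ?thesis
    by (simp only: algebra_simps)
qed

section \<open>Comparison in the fraction field\<close>

lemma to_fract_power: "to_fract (a ^ n) = to_fract a ^ n"
  by (induction n) simp_all

text \<open>Evaluating at \<open>t = 0\<close> and then \<open>q = 0\<close> would turn an equality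
  into \<open>0 = 1\<close>. This makes \<open>q^2\<close> an admissible base for the q-binomial
  identities.\<close>

lemma q_ind_power_neq_1:
  assumes "0 < n"
  shows "to_fract q_ind ^ n \<noteq> 1"
proof
  assume "to_fract q_ind ^ n = 1"
  then have "to_fract (q_ind ^ n) = to_fract 1"
    by (simp add: to_fract_power)
  then have "q_ind ^ n = 1"
    by (simp only: to_fract_eq_iff)
  then have "poly (q_ind ^ n) 0 = 1"
    by simp
  then have "[:0, 1:] ^ n = (1 :: int poly)"
    by (simp add: q_ind_def)
  then have "poly ([:0, 1:] ^ n) 0 = (1 :: int)"
    by simp
  with assms show False
    by (simp add: poly_power zero_power)
qed

theorem corollary1p2:
  fixes k :: nat and t q :: "int poly poly fract"
  defines "t \<equiv> to_fract t_ind" and "q \<equiv> to_fract q_ind"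
  shows "to_fract (T k) =
    (\<Sum>j = 0..k. \<Sum>i = 0..j.
       (- 1) ^ (j + i) * t ^ (2 * i) * q ^ (j\<^sup>2 + i\<^sup>2 + i)
       * qbinom (q\<^sup>2) (int k - int j) (int i)
       * (qbinom (q\<^sup>2) (int k - int i) (int j - int i)
          + t * qbinom (q\<^sup>2) (int k - int i - 1) (int j - int i - 1)))"
proof -
  define Q where "Q = q\<^sup>2"
  have nonroot: "\<forall>n>0. Q ^ n \<noteq> 1"
    using q_ind_power_neq_1[of "2 * _"] by (simp add: Q_def q_def flip: power_mult)
  note qsum_simps = qsum_0[OF nonroot] qsum_1[OF nonroot] qsum_Suc_Suc[OF nonroot]
  let ?S = "\<lambda>y. qsum Q (t\<^sup>2) (y * q)"
  let ?odd = "\<lambda>j i. (- 1) ^ (j + i) * t ^ (2 * i) * q ^ (j\<^sup>2 + i\<^sup>2 + i) * qbinom Q (int k - int j) (int i)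
          * qbinom Q (int k - int i - 1) (int j - int i - 1)"
  have T_eq: "to_fract (T k) = ?S 1 k - q * t * (case k of 0 \<Rightarrow> 0 | Suc m \<Rightarrow> ?S Q m)"
  proof (induction k rule: less_induct)
    case (less k)
    \<comment> \<open>The odd part has index \<open>k - 1\<close>, so its recurrence applies only
      from \<open>k = 3\<close> on; \<open>k = 2\<close> is checked directly.\<close>
    consider "k = 0" | "k = 1" | "k = 2" | m where "k = Suc (Suc (Suc m))"
      by (metis One_nat_def Suc_1 not0_implies_Suc)
    then show ?case
    proof cases
      case 1
      then show ?thesis by (simp add: qsum_simps)
    next
      case 2
      then show ?thesis by (simp add: qsum_simps t_def q_def algebra_simps)
    next
      case 3
      have "to_fract (T 2) = (1 - q ^ 3) * to_fract (T 1) + t\<^sup>2 * q ^ 3 * to_fract (T 0)"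
        using arg_cong[OF T_Suc_Suc[of 0], of to_fract]
        by (simp add: numeral_2_eq_2 q_def t_def to_fract_power del: T.simps)
      also have "to_fract (T 1) = 1 - q - q * t"
        by (simp add: t_def q_def algebra_simps)
      finally show ?thesis
        using 3 by (simp add: numeral_2_eq_2 qsum_simps del: T.simps)
          (simp add: Q_def power2_eq_square power3_eq_cube algebra_simps)
    next
      case 4
      define p where "p = q ^ (2 * m + 5)"
      \<comment> \<open>The first form is the coefficient in the \<open>qsum\<close> recurrence for
        \<open>z = q\<close>, the second for \<open>z = q^3\<close> at an index one lower. Both
        parts thus obey the recurrence of \<open>T\<close> with the same \<open>p\<close>.\<close>
      have p: "p = q * Q ^ Suc (Suc m)" "p = Q * q * Q ^ Suc m"
        by (simp_all add: p_def Q_def power_add flip: power_mult)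
          (simp_all add: eval_nat_numeral)
      have "to_fract (T k) = (1 - p) * to_fract (T (Suc (Suc m))) + t\<^sup>2 * p * to_fract (T (Suc m))"
        using arg_cong[OF T_Suc_Suc[of "Suc m"], of to_fract] 4
        by (simp add: add.commute[of "2 * m"] p_def q_def t_def to_fract_power del: T.simps)
      also have "\<dots> = (1 - p) * (?S 1 (Suc (Suc m)) - q * t * ?S Q (Suc m))
          + t\<^sup>2 * p * (?S 1 (Suc m) - q * t * ?S Q m)"
        using less.IH[of "Suc m"] less.IH[of "Suc (Suc m)"] 4 by (simp del: T.simps)
      also have "\<dots> = ((1 - p) * ?S 1 (Suc (Suc m)) + t\<^sup>2 * p * ?S 1 (Suc m))
          - q * t * ((1 - p) * ?S Q (Suc m) + t\<^sup>2 * p * ?S Q m)"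
        by (simp add: algebra_simps)
      also have "(1 - p) * ?S 1 (Suc (Suc m)) + t\<^sup>2 * p * ?S 1 (Suc m) = ?S 1 k"
        using qsum_Suc_Suc[OF nonroot, of "t\<^sup>2" "1 * q" "Suc m"] by (simp add: 4 p(1) mult_ac)
      also have "(1 - p) * ?S Q (Suc m) + t\<^sup>2 * p * ?S Q m = ?S Q (Suc (Suc m))"
        using qsum_Suc_Suc[OF nonroot, of "t\<^sup>2" "Q * q" m] by (simp add: p(2) mult_ac)
      finally show ?thesis by (simp add: 4)
    qed
  qed
  have even_eq: "(\<Sum>j\<le>k. \<Sum>i\<le>j. (- 1) ^ (j + i) * t ^ (2 * i) * q ^ (j\<^sup>2 + i\<^sup>2 + i)
       * qbinom Q (int k - int j) (int i) * qbinom Q (int k - int i) (int j - int i)) = ?S 1 k"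
    unfolding double_sum_eq_qsum[OF nonroot Q_def, symmetric]
    by (intro sum.cong) (simp_all add: of_nat_diff power_mult)
  have odd_eq: "(\<Sum>j\<le>k. \<Sum>i\<le>j. ?odd j i) = - q * (case k of 0 \<Rightarrow> 0 | Suc m \<Rightarrow> ?S Q m)"
  proof (cases k)
    case 0
    then show ?thesis by (simp add: qbinom_def)
  next
    case (Suc m)
    \<comment> \<open>For \<open>i = j\<close> the lower index is \<open>-1\<close>. Hence
      \<open>j = 0\<close> drops out and \<open>j\<close> can be shifted by one; this turns
      \<open>k\<close> into \<open>m\<close> and yields the factor \<open>- q * Q^j\<close>.\<close>
    have diag: "?odd j j = 0" for j
      by (simp add: qbinom_def)
    have "(\<Sum>j\<le>k. \<Sum>i\<le>j. ?odd j i) = (\<Sum>j\<le>m. \<Sum>i\<le>j. ?odd (Suc j) i)"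
      unfolding Suc sum.atMost_Suc_shift[of _ m] unfolding Suc[symmetric]
      unfolding sum.atMost_Suc diag by (simp add: qbinom_def)
    also have "\<dots> = (\<Sum>j\<le>m. \<Sum>i\<le>j. - q * ((- 1) ^ (j + i) * (t\<^sup>2) ^ i * Q ^ j * q ^ (j\<^sup>2 + i\<^sup>2 + i)
      * qbin Q (m - j) i * qbin Q (m - i) (j - i)))"
    proof (intro sum.cong refl)
      fix j i
      assume "j \<in> {..m}" "i \<in> {..j}"
      then have eqs: "int k - int (Suc j) = int (m - j)" "int k - int i - 1 = int (m - i)"
         "int (Suc j) - int i - 1 = int (j - i)"
        by (auto simp: Suc)
      have "q ^ ((Suc j)\<^sup>2 + i\<^sup>2 + i) = q * Q ^ j * q ^ (j\<^sup>2 + i\<^sup>2 + i)"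
        by (simp add: Q_def power2_eq_square power_add power_mult_distrib mult_ac flip: power_mult)
      then show "?odd (Suc j) i = - q * ((- 1) ^ (j + i) * (t\<^sup>2) ^ i * Q ^ j * q ^ (j\<^sup>2 + i\<^sup>2 + i)
        * qbin Q (m - j) i * qbin Q (m - i) (j - i))"
        unfolding eqs power_mult[of t] by (simp add: mult_ac)
    qed
    also have "\<dots> = - q * ?S Q m"
      unfolding sum_distrib_left[symmetric] double_sum_eq_qsum[OF nonroot Q_def] ..
    finally show ?thesis using Suc by simp
  qed
  have "(\<Sum>j\<le>k. \<Sum>i\<le>j. (- 1) ^ (j + i) * t ^ (2 * i) * q ^ (j\<^sup>2 + i\<^sup>2 + i)
       * qbinom Q (int k - int j) (int i)
       * (qbinom Q (int k - int i) (int j - int i)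
          + t * qbinom Q (int k - int i - 1) (int j - int i - 1)))
    = ?S 1 k + t * (\<Sum>j\<le>k. \<Sum>i\<le>j. ?odd j i)"
    unfolding even_eq[symmetric] sum_distrib_left sum.distrib[symmetric]
    by (intro sum.cong refl) (simp only: ring_distribs mult_ac)
  also have "\<dots> = to_fract (T k)"
    unfolding odd_eq T_eq by (simp add: mult_ac)
  finally show ?thesis
    by (simp add: Q_def atMost_atLeast0)
qed

end
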